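(* Suppose that an amenable discrete group $G$ acts on a nontrivial pointed metric space $(M,d,0)$ by similarities fixing the distinguished point, with associated similarity character $\chi\colon G\to(0,\infty)$. Then $\mathcal F^{G,\chi}(M)$ admits a linear isometric embedding into $\mathcal F(M)^{**}$. Moreover, $\operatorname{Lip}_0^{G,\chi}(M)$ is the range of a contractive projection on $\operatorname{Lip}_0(M)$, given by $$(P_{G,\chi}f)(x)=m_g\left[g\mapsto\chi(g)f(g^{-1}x)\right],\qquad f\in\operatorname{Lip}_0(M),\ x\in M,$$ where $m$ is a bi-invariant mean on $\ell_\infty(G)$. If $\operatorname{Lip}_0^{G,\chi}(M)\ne\{0\}$, this projection has norm one.
   Context: $\operatorname{Lip}_0(M)$ is the Banach space of Lipschitz functions $f\colon M\to\mathbb R$ with $f(0)=0$, normed by the least Lipschitz constant; $\delta_x\in\operatorname{Lip}_0(M)^*$ is evaluation at $x\in M$; $\mathcal F(M)=\overline{\operatorname{span}}\{\delta_x:x\in M\}\subseteq\operatorname{Lip}_0(M)^*$ is the Lipschitz-free space. $G$ acts by similarities if each $x\mapsto gx$ is a bijection multiplying distances by a fixed positive constant; the similarity character $\chi$ is the homomorphism $G\to(0,\infty)$ with $d(gx,gy)=\chi(g)d(x,y)$ for all $g\in G$, $x,y\in M$. $\operatorname{Lip}_0^{G,\chi}(M)=\{f\in\operatorname{Lip}_0(M): f(gx)=\chi(g)f(x)\text{ for all }g\in G,x\in M\}$, and $\mathcal F^{G,\chi}(M)=\mathcal F(M)/\overline{\operatorname{span}}\{\delta_{gx}-\chi(g)\delta_x:g\in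 G,x\in M\}$. A bi-invariant mean on $\ell_\infty(G)$ (bounded real functions on $G$) is a norm-one linear functional $m$ with $m(1)=1$ invariant under left and right translations; $m_g$ means $m$ applied to a bounded function of the variable $g$. A discrete group is amenable if such a mean exists. *)

theory Defs
  imports "HOL-Analysis.Analysis" "HOL-Algebra.Group_Action"
begin

section \<open>Lipschitz functions vanishing at the base point\<close>

text \<open>A pointed metric space is a type of sort \<open>{metric_space, zero}\<close>: the constant \<open>0\<close> is the
  distinguished point, and no law relates it to the metric.\<close>

typedef (overloaded) ('a :: "{metric_space, zero}") lip0 =
  "{f :: 'a \<Rightarrow> real. f 0 = 0 \<and> (\<exists>L. L-lipschitz_on UNIV f)}"
  morphisms apply_lip0 Lip0
  by (rule exI[of _ "\<lambda>_. 0"]) (auto intro!: exI[of _ 0] lipschitz_onI)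

setup_lifting type_definition_lip0

lemma lipschitz_on_add_real:
  fixes f g :: "'a :: metric_space \<Rightarrow> real"
  assumes "K-lipschitz_on X f" "L-lipschitz_on X g"
  shows "(K + L)-lipschitz_on X (\<lambda>x. f x + g x)"
  using assms by (rule lipschitz_on_add)

lemma lipschitz_on_cmult_abs:
  fixes f :: "'a :: metric_space \<Rightarrow> real"
  assumes "L-lipschitz_on X f"
  shows "(\<bar>c\<bar> * L)-lipschitz_on X (\<lambda>x. c * f x)"
  using assms by (rule lipschitz_on_cmult_real)

definition least_lipschitz_const :: "('a :: metric_space \<Rightarrow> real) \<Rightarrow> real" where
  "least_lipschitz_const f = Inf {L. L-lipschitz_on UNIV f}"

lemma least_lipschitz_const_le:
  "L-lipschitz_on UNIV f \<Longrightarrow> least_lipschitz_const f \<le> L"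
  unfolding least_lipschitz_const_def
  by (rule cInf_lower) (auto intro!: bdd_belowI[of _ 0] dest: lipschitz_on_nonneg)

lemma least_lipschitz_const_lipschitz:
  assumes "\<exists>L. L-lipschitz_on UNIV f"
  shows "(least_lipschitz_const f)-lipschitz_on UNIV f"
proof (rule lipschitz_onI)
  have ne: "{L. L-lipschitz_on UNIV f} \<noteq> {}"
    using assms by auto
  show "0 \<le> least_lipschitz_const f"
    unfolding least_lipschitz_const_def
    by (rule cInf_greatest[OF ne]) (auto dest: lipschitz_on_nonneg)
  fix x y
  show "dist (f x) (f y) \<le> least_lipschitz_const f * dist x y"
  proof (cases "x = y")
    case False
    have "dist (f x) (f y) / dist x y \<le> least_lipschitz_const f"
      unfolding least_lipschitz_const_def using False
      by (intro cInf_greatest[OF ne]) (auto simp: divide_simps dest: lipschitz_onD)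
    with False show ?thesis
      by (simp add: divide_simps)
  qed simp
qed

instantiation lip0 :: ("{metric_space, zero}") real_normed_vector
begin

lift_definition zero_lip0 :: "'a lip0" is "\<lambda>_. 0"
  by (auto intro!: exI[of _ 0] lipschitz_onI)

lift_definition plus_lip0 :: "'a lip0 \<Rightarrow> 'a lip0 \<Rightarrow> 'a lip0" is "\<lambda>f g x. f x + g x"
  by (auto intro: lipschitz_on_add_real)

lift_definition uminus_lip0 :: "'a lip0 \<Rightarrow> 'a lip0" is "\<lambda>f x. - f x"
  by (auto simp: lipschitz_on_minus_iff)

lift_definition minus_lip0 :: "'a lip0 \<Rightarrow> 'a lip0 \<Rightarrow> 'a lip0" is "\<lambda>f g x. f x - g x"
  by (auto intro: lipschitz_on_diff)

lift_definition scaleR_lip0 :: "real \<Rightarrow> 'a lip0 \<Rightarrow> 'a lip0" is "\<lambda>c f x. c * f x"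
  by (auto intro: lipschitz_on_cmult_abs)

lift_definition norm_lip0 :: "'a lip0 \<Rightarrow> real" is least_lipschitz_const .

definition dist_lip0 :: "'a lip0 \<Rightarrow> 'a lip0 \<Rightarrow> real" where
  "dist_lip0 f g = norm (f - g)"

definition sgn_lip0 :: "'a lip0 \<Rightarrow> 'a lip0" where
  "sgn_lip0 f = inverse (norm f) *\<^sub>R f"

definition uniformity_lip0 :: "('a lip0 \<times> 'a lip0) filter" where
  "uniformity_lip0 = (INF e\<in>{0<..}. principal {(f, g). dist f g < e})"

definition open_lip0 :: "'a lip0 set \<Rightarrow> bool" where
  "open_lip0 U \<longleftrightarrow> (\<forall>f\<in>U. eventually (\<lambda>(f', g). f' = f \<longrightarrow> g \<in> U) uniformity)"

instance
proof
  fix f g h :: "'a lip0" and a b :: real and U :: "'a lip0 set"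
  show "f + g + h = f + (g + h)" "f + g = g + f" "0 + f = f" "- f + f = 0" "f - g = f + - g"
    "a *\<^sub>R (f + g) = a *\<^sub>R f + a *\<^sub>R g" "(a + b) *\<^sub>R f = a *\<^sub>R f + b *\<^sub>R f"
    "a *\<^sub>R b *\<^sub>R f = (a * b) *\<^sub>R f" "1 *\<^sub>R f = f"
    by (transfer; simp add: algebra_simps)+
  show "dist f g = norm (f - g)" by (rule dist_lip0_def)
  show "sgn f = inverse (norm f) *\<^sub>R f" by (rule sgn_lip0_def)
  show "uniformity = (INF e\<in>{0<..}. principal {(f :: 'a lip0, g). dist f g < e})"
    by (rule uniformity_lip0_def)
  show "open U = (\<forall>f\<in>U. \<forall>\<^sub>F (f', g) in uniformity. f' = f \<longrightarrow> g \<in> U)"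
    by (rule open_lip0_def)
  show "norm f = 0 \<longleftrightarrow> f = 0"
  proof (transfer, safe)
    fix f :: "'a \<Rightarrow> real" and L
    assume f: "f 0 = 0" "L-lipschitz_on UNIV f" "least_lipschitz_const f = 0"
    then have "0-lipschitz_on UNIV f"
      using least_lipschitz_const_lipschitz[of f] by auto
    from lipschitz_onD[OF this, of _ 0] f(1) show "f = (\<lambda>_. 0)"
      by auto
  next
    have *: "0-lipschitz_on UNIV (\<lambda>_ :: 'a. 0 :: real)"
      by (auto intro!: lipschitz_onI)
    have "0 \<le> least_lipschitz_const (\<lambda>_ :: 'a. 0 :: real)"
      using * by (intro lipschitz_on_nonneg[OF least_lipschitz_const_lipschitz]) auto
    with least_lipschitz_const_le[OF *] show "least_lipschitz_const (\<lambda>_ :: 'a. 0 :: real) = 0"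
      by simp
  qed
  show "norm (f + g) \<le> norm f + norm g"
    by transfer (rule least_lipschitz_const_le, rule lipschitz_on_add_real;
        rule least_lipschitz_const_lipschitz, blast)
  have le: "norm (c *\<^sub>R k) \<le> \<bar>c\<bar> * norm k" for c and k :: "'a lip0"
    by transfer (rule least_lipschitz_const_le, rule lipschitz_on_cmult_abs,
        rule least_lipschitz_const_lipschitz, blast)
  show "norm (a *\<^sub>R f) = \<bar>a\<bar> * norm f"
  proof (cases "a = 0")
    case True
    have "0 \<le> norm (a *\<^sub>R f)"
      by transfer (rule lipschitz_on_nonneg, rule least_lipschitz_const_lipschitz,
          blast intro: lipschitz_on_cmult_abs)
    with True le[of a f] show ?thesis by simp
  next
    case False
    have "inverse a *\<^sub>R a *\<^sub>R f = f"
      using False by transfer (simp add: field_simps)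
    with le[of "inverse a" "a *\<^sub>R f"] have "norm f \<le> norm (a *\<^sub>R f) / \<bar>a\<bar>"
      by (simp add: field_simps)
    with False le[of a f] show ?thesis
      by (simp add: field_simps)
  qed
qed

end

lemma abs_apply_lip0_le: "\<bar>apply_lip0 f x\<bar> \<le> norm f * dist x 0"
proof (transfer, elim conjE)
  fix f :: "'a \<Rightarrow> real" and x
  assume f: "f 0 = 0" "\<exists>L. L-lipschitz_on UNIV f"
  from lipschitz_onD[OF least_lipschitz_const_lipschitz[OF f(2)], of x 0] f(1)
  show "\<bar>f x\<bar> \<le> least_lipschitz_const f * dist x 0"
    by (simp add: dist_real_def)
qed


section \<open>The Lipschitz-free space\<close>

lift_definition lip0_delta :: "'a :: {metric_space, zero} \<Rightarrow> 'a lip0 \<Rightarrow>\<^sub>L real"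
  is "\<lambda>x f. apply_lip0 f x"
proof (rule bounded_linear_intro)
  fix x :: 'a and f g :: "'a lip0" and c :: real
  show "apply_lip0 (f + g) x = apply_lip0 f x + apply_lip0 g x"
    by transfer simp
  show "apply_lip0 (c *\<^sub>R f) x = c *\<^sub>R apply_lip0 f x"
    by transfer simp
  show "norm (apply_lip0 f x) \<le> norm f * dist x 0"
    by (simp add: abs_apply_lip0_le)
qed

lemma subspace_closure_span:
  fixes S :: "'a :: real_normed_vector set"
  shows "subspace (closure (span S))"
proof (rule subspaceI)
  show "0 \<in> closure (span S)"
    using closure_subset span_zero by blast
next
  fix x y assume "x \<in> closure (span S)" "y \<in> closure (span S)"
  then obtain u v where "\<And>n. u n \<in> span S" "u \<longlonglongrightarrow> x" "\<And>n. v n \<in> span S" "v \<longlonglongrightarrow> y"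
    by (auto simp: closure_sequential)
  then show "x + y \<in> closure (span S)"
    unfolding closure_sequential
    by (intro exI[of _ "\<lambda>n. u n + v n"]) (auto intro: span_add tendsto_add)
next
  fix c x assume "x \<in> closure (span S)"
  then obtain u where "\<And>n. u n \<in> span S" "u \<longlonglongrightarrow> x"
    by (auto simp: closure_sequential)
  then show "c *\<^sub>R x \<in> closure (span S)"
    unfolding closure_sequential
    by (intro exI[of _ "\<lambda>n. c *\<^sub>R u n"]) (auto intro: span_scale tendsto_scaleR)
qed

typedef (overloaded) ('a :: "{metric_space, zero}") lipschitz_free =
  "closure (span (range lip0_delta)) :: ('a lip0 \<Rightarrow>\<^sub>L real) set"
  morphisms functional_of_free Free
  by (rule exI) (rule subspace_0[OF subspace_closure_span])

setup_lifting type_definition_lipschitz_free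

instantiation lipschitz_free :: ("{metric_space, zero}") real_normed_vector
begin

lift_definition zero_lipschitz_free :: "'a lipschitz_free" is 0
  by (rule subspace_0[OF subspace_closure_span])

lift_definition plus_lipschitz_free ::
  "'a lipschitz_free \<Rightarrow> 'a lipschitz_free \<Rightarrow> 'a lipschitz_free" is "(+)"
  by (rule subspace_add[OF subspace_closure_span])

lift_definition uminus_lipschitz_free :: "'a lipschitz_free \<Rightarrow> 'a lipschitz_free" is uminus
  by (rule subspace_neg[OF subspace_closure_span])

lift_definition minus_lipschitz_free ::
  "'a lipschitz_free \<Rightarrow> 'a lipschitz_free \<Rightarrow> 'a lipschitz_free" is "(-)"
  by (rule subspace_diff[OF subspace_closure_span])

lift_definition scaleR_lipschitz_free ::
  "real \<Rightarrow> 'a lipschitz_free \<Rightarrow> 'a lipschitz_free" is scaleR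
  by (rule subspace_scale[OF subspace_closure_span])

lift_definition norm_lipschitz_free :: "'a lipschitz_free \<Rightarrow> real" is norm .

definition dist_lipschitz_free :: "'a lipschitz_free \<Rightarrow> 'a lipschitz_free \<Rightarrow> real" where
  "dist_lipschitz_free x y = norm (x - y)"

definition sgn_lipschitz_free :: "'a lipschitz_free \<Rightarrow> 'a lipschitz_free" where
  "sgn_lipschitz_free x = inverse (norm x) *\<^sub>R x"

definition uniformity_lipschitz_free :: "('a lipschitz_free \<times> 'a lipschitz_free) filter" where
  "uniformity_lipschitz_free = (INF e\<in>{0<..}. principal {(x, y). dist x y < e})"

definition open_lipschitz_free :: "'a lipschitz_free set \<Rightarrow> bool" where
  "open_lipschitz_free U \<longleftrightarrow>
    (\<forall>x\<in>U. eventually (\<lambda>(x', y). x' = x \<longrightarrow> y \<in> U) uniformity)"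

instance
proof
  fix x y z :: "'a lipschitz_free" and a b :: real and U :: "'a lipschitz_free set"
  show "x + y + z = x + (y + z)" "x + y = y + x" "0 + x = x" "- x + x = 0" "x - y = x + - y"
    "a *\<^sub>R (x + y) = a *\<^sub>R x + a *\<^sub>R y" "(a + b) *\<^sub>R x = a *\<^sub>R x + b *\<^sub>R x"
    "a *\<^sub>R b *\<^sub>R x = (a * b) *\<^sub>R x" "1 *\<^sub>R x = x"
    by (transfer; simp add: algebra_simps)+
  show "dist x y = norm (x - y)" by (rule dist_lipschitz_free_def)
  show "sgn x = inverse (norm x) *\<^sub>R x" by (rule sgn_lipschitz_free_def)
  show "uniformity = (INF e\<in>{0<..}. principal {(x :: 'a lipschitz_free, y). dist x y < e})"
    by (rule uniformity_lipschitz_free_def)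
  show "open U = (\<forall>x\<in>U. \<forall>\<^sub>F (x', y) in uniformity. x' = x \<longrightarrow> y \<in> U)"
    by (rule open_lipschitz_free_def)
  show "norm x = 0 \<longleftrightarrow> x = 0" by transfer simp
  show "norm (x + y) \<le> norm x + norm y" by transfer (rule norm_triangle_ineq)
  show "norm (a *\<^sub>R x) = \<bar>a\<bar> * norm x" by transfer simp
qed

end

lift_definition free_delta :: "'a :: {metric_space, zero} \<Rightarrow> 'a lipschitz_free" is lip0_delta
  by (rule subsetD[OF closure_subset span_base[OF rangeI]])


section \<open>Actions by similarities and the associated spaces\<close>

definition positive_reals_group :: "real monoid" where
  "positive_reals_group = \<lparr>carrier = {0<..}, mult = (*), one = 1\<rparr>"

definition acts_by_similarities ::
  "('g, 'b) monoid_scheme \<Rightarrow> ('g \<Rightarrow> 'a :: metric_space \<Rightarrow> 'a) \<Rightarrow> ('g \<Rightarrow> real) \<Rightarrow> bool" where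
  "acts_by_similarities G \<phi> chi \<longleftrightarrow>
    group_action G UNIV \<phi> \<and> chi \<in> hom G positive_reals_group \<and>
    (\<forall>g\<in>carrier G. \<forall>x y. dist (\<phi> g x) (\<phi> g y) = chi g * dist x y)"

definition lip0_equivariant ::
  "('g, 'b) monoid_scheme \<Rightarrow> ('g \<Rightarrow> 'a :: {metric_space, zero} \<Rightarrow> 'a) \<Rightarrow> ('g \<Rightarrow> real) \<Rightarrow>
    'a lip0 set" where
  "lip0_equivariant G \<phi> chi =
    {f. \<forall>g\<in>carrier G. \<forall>x. apply_lip0 f (\<phi> g x) = chi g * apply_lip0 f x}"

definition free_relations ::
  "('g, 'b) monoid_scheme \<Rightarrow> ('g \<Rightarrow> 'a :: {metric_space, zero} \<Rightarrow> 'a) \<Rightarrow> ('g \<Rightarrow> real) \<Rightarrow>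
    'a lipschitz_free set" where
  "free_relations G \<phi> chi =
    closure (span {free_delta (\<phi> g x) - chi g *\<^sub>R free_delta x | g x. g \<in> carrier G})"


section \<open>Quotients of normed spaces\<close>

text \<open>The quotient of a normed space by a closed subspace \<open>N\<close> is its set of cosets
  \<open>subspace_coset N x\<close>. Its operations are induced from representatives, and its norm is
  \<open>coset_norm\<close>.
  A map on the quotient is a function on sets of which only the values at cosets matter.\<close>

definition subspace_coset :: "'v :: real_normed_vector set \<Rightarrow> 'v \<Rightarrow> 'v set" where
  "subspace_coset N x = (\<lambda>n. x + n) ` N"

definition coset_norm :: "'v :: real_normed_vector set \<Rightarrow> real" where
  "coset_norm A = (INF a\<in>A. norm a)"

definition quotient_linear_isometry ::
  "'v :: real_normed_vector set \<Rightarrow> ('v set \<Rightarrow> 'w :: real_normed_vector) \<Rightarrow> bool" where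
  "quotient_linear_isometry N T \<longleftrightarrow>
    (\<forall>x y. T (subspace_coset N (x + y)) = T (subspace_coset N x) + T (subspace_coset N y)) \<and>
    (\<forall>c x. T (subspace_coset N (c *\<^sub>R x)) = c *\<^sub>R T (subspace_coset N x)) \<and>
    (\<forall>x. norm (T (subspace_coset N x)) = coset_norm (subspace_coset N x))"


section \<open>Amenability of discrete groups\<close>

text \<open>Functions on the group are represented by extensional functions on its carrier; a mean is
  unconstrained off \<open>linf G\<close>.\<close>

definition linf :: "('g, 'b) monoid_scheme \<Rightarrow> ('g \<Rightarrow> real) set" where
  "linf G = {u \<in> extensional (carrier G). bounded (u ` carrier G)}"

definition linf_norm :: "('g, 'b) monoid_scheme \<Rightarrow> ('g \<Rightarrow> real) \<Rightarrow> real" where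
  "linf_norm G u = (SUP g\<in>carrier G. \<bar>u g\<bar>)"

text \<open>The boundedness clause is needed besides the value of the operator norm because the supremum
  of an unbounded set of reals is an unspecified number.\<close>

definition bi_invariant_mean :: "('g, 'b) monoid_scheme \<Rightarrow> (('g \<Rightarrow> real) \<Rightarrow> real) \<Rightarrow> bool" where
  "bi_invariant_mean G m \<longleftrightarrow>
    (\<forall>u\<in>linf G. \<forall>v\<in>linf G. m (\<lambda>g\<in>carrier G. u g + v g) = m u + m v) \<and>
    (\<forall>c. \<forall>u\<in>linf G. m (\<lambda>g\<in>carrier G. c * u g) = c * m u) \<and>
    (\<exists>C. \<forall>u\<in>linf G. \<bar>m u\<bar> \<le> C * linf_norm G u) \<and>
    (SUP u\<in>{u \<in> linf G. linf_norm G u \<le> 1}. \<bar>m u\<bar>) = 1 \<and>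
    m (\<lambda>g\<in>carrier G. 1) = 1 \<and>
    (\<forall>h\<in>carrier G. \<forall>u\<in>linf G.
      m (\<lambda>g\<in>carrier G. u (h \<otimes>\<^bsub>G\<^esub> g)) = m u \<and>
      m (\<lambda>g\<in>carrier G. u (g \<otimes>\<^bsub>G\<^esub> h)) = m u)"

definition amenable :: "('g, 'b) monoid_scheme \<Rightarrow> bool" where
  "amenable G \<longleftrightarrow> group G \<and> (\<exists>m. bi_invariant_mean G m)"

end

theory Submission
  imports Defs
begin

text \<open>
  The average \<open>P f x = m (g \<mapsto> chi g * f (inv g x))\<close> makes sense because the factor by which
  \<open>inv g\<close> scales distances cancels \<open>chi g\<close>: as the base point is fixed, the averaged function is
  bounded by \<open>norm f * dist x 0\<close>, and two such functions for \<open>x\<close> and \<open>y\<close> differ by at most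
  \<open>norm f * dist x y\<close>. A mean does not increase suprema, so \<open>P\<close> is a contraction of the Lipschitz
  functions. Left invariance of \<open>m\<close> makes \<open>P f\<close> equivariant, and if \<open>f\<close> is already equivariant
  then the averaged function is constantly \<open>f x\<close>. Hence \<open>P\<close> is a contractive projection onto the
  equivariant functions.

  For the embedding, let \<open>N\<close> be the closed subspace of relations. Restriction to the point
  evaluations maps the dual of the free space into the Lipschitz functions without increasing norms,
  and the pairing with the free space is preserved since the point evaluations span a dense
  subspace. The functionals that vanish on \<open>N\<close> are sent to equivariant functions. The map \<open>T\<close> sends
  the coset of \<open>\<mu>\<close> to the functional \<open>\<psi> \<mapsto> \<mu> (P (\<psi> restricted to M))\<close>. Values of \<open>P\<close>
  are equivariant and so annihilate \<open>N\<close>; thus \<open>T\<close> is well defined and bounded by the norm of every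
  representative. Conversely, the Hahn-Banach theorem yields a functional \<open>\<psi>\<close> of norm at most one
  that vanishes on \<open>N\<close> and takes at \<open>\<mu>\<close> the quotient norm of the coset. Its restriction is fixed
  by \<open>P\<close>, so \<open>T\<close> attains the quotient norm there, and is isometric.
\<close>


section \<open>The Hahn-Banach theorem for sublinear functionals\<close>

definition sublinear :: "('v :: real_vector \<Rightarrow> real) \<Rightarrow> bool" where
  "sublinear q \<longleftrightarrow> (\<forall>x y. q (x + y) \<le> q x + q y) \<and> (\<forall>c>0. \<forall>x. q (c *\<^sub>R x) \<le> c * q x)"

lemma sublinearI:
  assumes "\<And>x y. q (x + y) \<le> q x + q y" "\<And>c x. c > 0 \<Longrightarrow> q (c *\<^sub>R x) \<le> c * q x"
  shows "sublinear q"
  using assms by (auto simp: sublinear_def)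

lemma sublinear_add: "sublinear q \<Longrightarrow> q (x + y) \<le> q x + q y"
  by (simp add: sublinear_def)

lemma sublinear_scale_le: "sublinear q \<Longrightarrow> c > 0 \<Longrightarrow> q (c *\<^sub>R x) \<le> c * q x"
  by (simp add: sublinear_def)

lemma sublinear_zero:
  assumes "sublinear q"
  shows "q 0 = 0"
  using sublinear_scale_le[OF assms, of 2 0] sublinear_scale_le[OF assms, of "1/2" 0] by simp

lemma sublinear_scale:
  assumes "sublinear q" "c \<ge> 0"
  shows "q (c *\<^sub>R x) = c * q x"
proof (cases "c = 0")
  case True
  then show ?thesis by (simp add: sublinear_zero[OF assms(1)])
next
  case False
  with assms have c: "c > 0" by simp
  have "q (inverse c *\<^sub>R (c *\<^sub>R x)) \<le> inverse c * q (c *\<^sub>R x)"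
    using c by (intro sublinear_scale_le[OF assms(1)]) simp
  then have "c * q x \<le> q (c *\<^sub>R x)"
    using c by (simp add: field_simps)
  with sublinear_scale_le[OF assms(1) c, of x] show ?thesis by simp
qed

lemma sublinear_minus_ge:
  assumes "sublinear q"
  shows "- q (- x) \<le> q x"
  using sublinear_add[OF assms, of x "- x"] sublinear_zero[OF assms] by simp

text \<open>Minimality forces linearity: tilting \<open>q\<close> in the direction \<open>x\<close> gives a sublinear functional
  below \<open>q\<close> whose value at \<open>- x\<close> is at most \<open>- q x\<close>. The tilt also serves to prescribe the value
  of a dominated linear functional at one vector.\<close>

definition tilt :: "('v :: real_vector \<Rightarrow> real) \<Rightarrow> 'v \<Rightarrow> 'v \<Rightarrow> real" where
  "tilt q x y = (INF t\<in>{0..}. q (y + t *\<^sub>R x) - t * q x)"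

lemma tilt_upper:
  assumes "sublinear q" "t \<ge> 0"
  shows "tilt q x y \<le> q (y + t *\<^sub>R x) - t * q x"
  unfolding tilt_def
proof (rule cINF_lower)
  have "- q (- y) \<le> q (y + s *\<^sub>R x) - s * q x" if "s \<ge> 0" for s
    using sublinear_add[OF assms(1), of "y + s *\<^sub>R x" "- y"] sublinear_scale[OF assms(1) that, of x]
    by simp
  then show "bdd_below ((\<lambda>t. q (y + t *\<^sub>R x) - t * q x) ` {0..})"
    by (intro bdd_belowI2) auto
qed (use assms in simp)

lemma tilt_greatest:
  assumes "\<And>t. t \<ge> 0 \<Longrightarrow> b \<le> q (y + t *\<^sub>R x) - t * q x"
  shows "b \<le> tilt q x y"
  unfolding tilt_def using assms by (intro cINF_greatest) auto

lemma tilt_le: "sublinear q \<Longrightarrow> tilt q x y \<le> q y"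
  using tilt_upper[of q 0 x y] by simp

lemma tilt_uminus_le: "sublinear q \<Longrightarrow> tilt q x (- x) \<le> - q x"
  using tilt_upper[of q 1 x "- x"] sublinear_zero[of q] by simp

lemma sublinear_tilt:
  assumes q: "sublinear q"
  shows "sublinear (tilt q x)"
proof (rule sublinearI)
  fix y z
  have step: "tilt q x (y + z) \<le> (q (y + s *\<^sub>R x) - s * q x) + (q (z + t *\<^sub>R x) - t * q x)"
    if "s \<ge> 0" "t \<ge> 0" for s t
  proof -
    have "tilt q x (y + z) \<le> q ((y + z) + (s + t) *\<^sub>R x) - (s + t) * q x"
      using that by (intro tilt_upper[OF q]) simp
    also have "(y + z) + (s + t) *\<^sub>R x = (y + s *\<^sub>R x) + (z + t *\<^sub>R x)"
      by (simp add: algebra_simps)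
    also have "q \<dots> \<le> q (y + s *\<^sub>R x) + q (z + t *\<^sub>R x)"
      by (rule sublinear_add[OF q])
    finally show ?thesis by (simp add: algebra_simps)
  qed
  have "tilt q x (y + z) - (q (y + s *\<^sub>R x) - s * q x) \<le> tilt q x z" if "s \<ge> 0" for s
    by (rule tilt_greatest) (use step[OF that] in \<open>simp add: algebra_simps\<close>)
  then have "tilt q x (y + z) - tilt q x z \<le> tilt q x y"
    by (intro tilt_greatest) (simp add: algebra_simps)
  then show "tilt q x (y + z) \<le> tilt q x y + tilt q x z" by simp
next
  fix c :: real and y assume c: "c > 0"
  have "tilt q x (c *\<^sub>R y) / c \<le> tilt q x y"
  proof (rule tilt_greatest)
    fix t :: real assume t: "t \<ge> 0"
    have "tilt q x (c *\<^sub>R y) \<le> q (c *\<^sub>R y + (c * t) *\<^sub>R x) - (c * t) * q x"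
      using c t by (intro tilt_upper[OF q]) simp
    also have "c *\<^sub>R y + (c * t) *\<^sub>R x = c *\<^sub>R (y + t *\<^sub>R x)"
      by (simp add: algebra_simps)
    also have "q \<dots> = c * q (y + t *\<^sub>R x)"
      using c by (intro sublinear_scale[OF q]) simp
    finally show "tilt q x (c *\<^sub>R y) / c \<le> q (y + t *\<^sub>R x) - t * q x"
      using c by (simp add: field_simps)
  qed
  then show "tilt q x (c *\<^sub>R y) \<le> c * tilt q x y"
    using c by (simp add: field_simps)
qed

lemma sublinear_INF_chain:
  assumes ne: "C \<noteq> {}"
    and sub: "\<And>q. q \<in> C \<Longrightarrow> sublinear q"
    and chain: "\<And>q r. q \<in> C \<Longrightarrow> r \<in> C \<Longrightarrow> q \<le> r \<or> r \<le> q"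
    and bdd: "\<And>x. bdd_below ((\<lambda>q. q x) ` C)"
  shows "sublinear (\<lambda>x. INF q\<in>C. q x)"
proof (rule sublinearI)
  let ?r = "\<lambda>x. INF q\<in>C. q x"
  have lower: "?r x \<le> q x" if "q \<in> C" for q x
    by (rule cINF_lower[OF bdd that])
  fix x y
  have sum: "?r (x + y) \<le> q1 x + q2 y" if q12: "q1 \<in> C" "q2 \<in> C" for q1 q2
  proof -
    obtain q where q: "q \<in> C" "q \<le> q1" "q \<le> q2"
      using chain[OF q12] q12 by blast
    have "?r (x + y) \<le> q (x + y)" by (rule lower[OF q(1)])
    also have "\<dots> \<le> q x + q y" by (rule sublinear_add[OF sub[OF q(1)]])
    also have "\<dots> \<le> q1 x + q2 y" using q(2,3) by (intro add_mono) (auto dest: le_funD)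
    finally show ?thesis .
  qed
  have "?r (x + y) - q1 x \<le> ?r y" if "q1 \<in> C" for q1
    by (rule cINF_greatest[OF ne]) (use sum[OF that] in \<open>simp add: diff_le_eq add.commute\<close>)
  then have "?r (x + y) - ?r y \<le> ?r x"
    by (intro cINF_greatest[OF ne]) (simp add: algebra_simps)
  then show "?r (x + y) \<le> ?r x + ?r y" by simp
next
  let ?r = "\<lambda>x. INF q\<in>C. q x"
  fix c :: real and x assume c: "c > 0"
  have "?r (c *\<^sub>R x) / c \<le> q x" if "q \<in> C" for q
    using cINF_lower[OF bdd that, of "c *\<^sub>R x"] sublinear_scale_le[OF sub[OF that] c, of x] c
    by (simp add: field_simps)
  then have "?r (c *\<^sub>R x) / c \<le> ?r x"
    by (rule cINF_greatest[OF ne])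
  then show "?r (c *\<^sub>R x) \<le> c * ?r x"
    using c by (simp add: field_simps)
qed

text \<open>Zorn's lemma applies because all sublinear functionals below \<open>p\<close> are bounded from below at
  \<open>x\<close> by \<open>- p (- x)\<close>, so that chains have pointwise infima.\<close>

lemma minimal_sublinear_below:
  assumes p: "sublinear p"
  obtains q where "sublinear q" "q \<le> p" "\<And>r. sublinear r \<Longrightarrow> r \<le> q \<Longrightarrow> r = q"
proof -
  let ?A = "{q. sublinear q \<and> q \<le> p}"
  have "\<exists>q\<in>?A. \<forall>r\<in>?A. r \<le> q \<longrightarrow> r = q"
  proof (rule predicate_Zorn)
    show "partial_order_on ?A (relation_of (\<lambda>q r. r \<le> q) ?A)"
      by (rule partial_order_on_relation_ofI) auto
  next
    fix C assume C: "C \<in> Chains (relation_of (\<lambda>q r. r \<le> q) ?A)"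
    then have CA: "C \<subseteq> ?A"
      by (auto simp: Chains_def relation_of_def)
    have chain: "q \<le> r \<or> r \<le> q" if "q \<in> C" "r \<in> C" for q r
      using C that by (auto simp: Chains_def relation_of_def)
    show "\<exists>u\<in>?A. \<forall>q\<in>C. u \<le> q"
    proof (cases "C = {}")
      case True
      then show ?thesis using p by auto
    next
      case False
      let ?r = "\<lambda>x. INF q\<in>C. q x"
      have "- p (- x) \<le> q x" if "q \<in> C" for q x
        using that CA sublinear_minus_ge[of q x] le_funD[of q p "- x"] by auto
      then have bdd: "bdd_below ((\<lambda>q. q x) ` C)" for x
        by (intro bdd_belowI2)
      have lower: "?r \<le> q" if "q \<in> C" for q
        by (rule le_funI) (rule cINF_lower[OF bdd that])
      have "sublinear ?r"
        using CA by (intro sublinear_INF_chain[OF False _ chain bdd]) auto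
      moreover have "?r \<le> p"
        using False lower CA order_trans by blast
      ultimately show ?thesis using lower by blast
    qed
  qed
  then show thesis
    using that order_trans by blast
qed

theorem linear_functional_below_sublinear:
  fixes p :: "'v :: real_vector \<Rightarrow> real"
  assumes p: "sublinear p"
  obtains f where "linear f" "\<And>y. f y \<le> p y" "f x = p x"
proof -
  obtain q where q: "sublinear q" "q \<le> tilt p x" "\<And>r. sublinear r \<Longrightarrow> r \<le> q \<Longrightarrow> r = q"
    by (rule minimal_sublinear_below[OF sublinear_tilt[OF p, of x]]) blast
  have odd: "q (- y) = - q y" for y
  proof -
    have "tilt q y = q"
      by (rule q(3)[OF sublinear_tilt[OF q(1)]]) (simp add: le_fun_def tilt_le[OF q(1)])
    then have "q (- y) \<le> - q y"
      using tilt_uminus_le[OF q(1), of y] by simp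
    with sublinear_minus_ge[OF q(1), of y] show ?thesis by simp
  qed
  have "q (y + z) = q y + q z" for y z
    using sublinear_add[OF q(1), of y z] sublinear_add[OF q(1), of "- y" "- z"]
      odd[of y] odd[of z] odd[of "y + z"] by simp
  moreover have "q (c *\<^sub>R y) = c * q y" for c y
    using sublinear_scale[OF q(1), of c y] sublinear_scale[OF q(1), of "- c" y]
      odd[of "c *\<^sub>R y"] by (cases "c \<ge> 0") auto
  ultimately have "linear q"
    by (intro linearI) auto
  moreover have le: "q y \<le> p y" for y
    using le_funD[OF q(2), of y] tilt_le[OF p, of x y] by simp
  moreover have "q x = p x"
    \<comment> \<open>The tilt of \<open>p\<close> was chosen so that \<open>- q x = q (- x) \<le> - p x\<close>.\<close>
    using le_funD[OF q(2), of "- x"] tilt_uminus_le[OF p, of x] odd[of x] le[of x] by simp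
  ultimately show thesis by (rule that)
qed


section \<open>Functionals attaining a quotient norm\<close>

lemma coset_norm_eq: "coset_norm (subspace_coset N x) = (INF n\<in>N. norm (x + n))"
  by (simp add: coset_norm_def subspace_coset_def image_image)

lemma coset_norm_le: "n \<in> N \<Longrightarrow> coset_norm (subspace_coset N x) \<le> norm (x + n)"
  unfolding coset_norm_eq by (rule cINF_lower) (auto intro!: bdd_belowI2[of _ 0])

lemma coset_norm_greatest:
  assumes "subspace N" "\<And>n. n \<in> N \<Longrightarrow> b \<le> norm (x + n)"
  shows "b \<le> coset_norm (subspace_coset N x)"
  unfolding coset_norm_eq using assms subspace_0[OF assms(1)] by (intro cINF_greatest) auto

lemma coset_norm_le_norm: "subspace N \<Longrightarrow> coset_norm (subspace_coset N x) \<le> norm x"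
  using coset_norm_le[of 0 N x] subspace_0[of N] by simp

lemma coset_norm_mem_le:
  assumes "subspace N" "n \<in> N"
  shows "coset_norm (subspace_coset N n) \<le> 0"
  using coset_norm_le[OF subspace_neg[OF assms], of n] by simp

lemma sublinear_coset_norm:
  assumes N: "subspace N"
  shows "sublinear (\<lambda>x. coset_norm (subspace_coset N x))"
proof (rule sublinearI)
  let ?p = "\<lambda>x. coset_norm (subspace_coset N x)"
  fix x y
  have sum: "?p (x + y) \<le> norm (x + n) + norm (y + k)" if "n \<in> N" "k \<in> N" for n k
    using coset_norm_le[OF subspace_add[OF N that], of "x + y"]
      norm_triangle_ineq[of "x + n" "y + k"] by (simp add: algebra_simps)
  have "?p (x + y) - norm (x + n) \<le> ?p y" if "n \<in> N" for n
    by (rule coset_norm_greatest[OF N]) (use sum[OF that] in \<open>simp add: diff_le_eq add.commute\<close>)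
  then have "?p (x + y) - ?p y \<le> ?p x"
    by (intro coset_norm_greatest[OF N]) (simp add: algebra_simps)
  then show "?p (x + y) \<le> ?p x + ?p y" by simp
next
  let ?p = "\<lambda>x. coset_norm (subspace_coset N x)"
  fix c :: real and x assume c: "c > 0"
  have "?p (c *\<^sub>R x) / c \<le> norm (x + n)" if "n \<in> N" for n
  proof -
    have "?p (c *\<^sub>R x) \<le> norm (c *\<^sub>R x + c *\<^sub>R n)"
      by (rule coset_norm_le[OF subspace_scale[OF N that]])
    also have "\<dots> = c * norm (x + n)"
      using c by (simp flip: scaleR_add_right)
    finally show ?thesis using c by (simp add: field_simps)
  qed
  then have "?p (c *\<^sub>R x) / c \<le> ?p x"
    by (rule coset_norm_greatest[OF N])
  then show "?p (c *\<^sub>R x) \<le> c * ?p x"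
    using c by (simp add: field_simps)
qed

text \<open>The quotient norm, seen as a seminorm on the whole space, is sublinear. A linear functional
  below it is bounded by the norm, and vanishes on \<open>N\<close> because the seminorm does.\<close>

lemma annihilating_functional_attains_coset_norm:
  fixes N :: "'v :: real_normed_vector set"
  assumes N: "subspace N"
  obtains \<psi> :: "'v \<Rightarrow>\<^sub>L real"
  where "norm \<psi> \<le> 1" "\<And>n. n \<in> N \<Longrightarrow> blinfun_apply \<psi> n = 0"
    "blinfun_apply \<psi> x = coset_norm (subspace_coset N x)"
proof -
  let ?p = "\<lambda>x. coset_norm (subspace_coset N x)"
  obtain f where f: "linear f" "\<And>y. f y \<le> ?p y" "f x = ?p x"
    by (rule linear_functional_below_sublinear[OF sublinear_coset_norm[OF N], of x]) blast
  have neg: "f (- y) = - f y" for y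
    by (rule linear_neg[OF f(1)])
  have bound: "\<bar>f y\<bar> \<le> norm y" for y
    using f(2)[of y] f(2)[of "- y"] neg[of y] coset_norm_le_norm[OF N, of y]
      coset_norm_le_norm[OF N, of "- y"] by simp
  have bl: "bounded_linear f"
    using bound by (intro bounded_linear_intro[of _ 1])
      (auto simp: linear_add[OF f(1)] linear_scale[OF f(1)])
  show thesis
  proof (rule that[of "Blinfun f"])
    show "norm (Blinfun f) \<le> 1"
      using bound by (intro norm_blinfun_bound) (auto simp: bounded_linear_Blinfun_apply[OF bl])
    show "blinfun_apply (Blinfun f) n = 0" if "n \<in> N" for n
      using f(2)[of n] f(2)[of "- n"] neg[of n] coset_norm_mem_le[OF N that]
        coset_norm_mem_le[OF N subspace_neg[OF N that]]
      by (simp add: bounded_linear_Blinfun_apply[OF bl])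
    show "blinfun_apply (Blinfun f) x = ?p x"
      by (simp add: bounded_linear_Blinfun_apply[OF bl] f(3))
  qed
qed


section \<open>The dual of the Lipschitz-free space\<close>

lemma lip0_apply_simps:
  "apply_lip0 (f + g) x = apply_lip0 f x + apply_lip0 g x"
  "apply_lip0 (c *\<^sub>R f) x = c * apply_lip0 f x"
  "apply_lip0 0 x = 0"
  by (transfer; simp)+

lemma lip0_diff_le: "\<bar>apply_lip0 f x - apply_lip0 f y\<bar> \<le> norm f * dist x y"
proof (transfer, elim conjE)
  fix f :: "'a \<Rightarrow> real" and x y
  assume "\<exists>L. L-lipschitz_on UNIV f"
  from lipschitz_onD[OF least_lipschitz_const_lipschitz[OF this], of x y]
  show "\<bar>f x - f y\<bar> \<le> least_lipschitz_const f * dist x y"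
    by (simp add: dist_real_def)
qed

lemma lip0_zero: "apply_lip0 f 0 = 0"
  using apply_lip0[of f] by simp

lemma Lip0_props:
  assumes "h 0 = 0" "L \<ge> 0" "\<And>x y. \<bar>h x - h y\<bar> \<le> L * dist x y"
  shows apply_Lip0: "apply_lip0 (Lip0 h) = h" and norm_Lip0_le: "norm (Lip0 h) \<le> L"
proof -
  have L: "L-lipschitz_on UNIV h"
    using assms by (intro lipschitz_onI) (auto simp: dist_real_def)
  then show *: "apply_lip0 (Lip0 h) = h"
    using assms(1) by (intro Lip0_inverse) auto
  show "norm (Lip0 h) \<le> L"
    using least_lipschitz_const_le[OF L] by (simp add: norm_lip0.rep_eq *)
qed

lemma bounded_linear_functional_of_free: "bounded_linear functional_of_free"
  by (rule bounded_linear_intro[of _ 1])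
    (auto simp: plus_lipschitz_free.rep_eq scaleR_lipschitz_free.rep_eq norm_lipschitz_free.rep_eq)

lemma dist_functional_of_free: "dist (functional_of_free \<mu>) (functional_of_free \<nu>) = dist \<mu> \<nu>"
  by (simp add: dist_norm norm_lipschitz_free.rep_eq minus_lipschitz_free.rep_eq)

lemma functional_of_free_delta: "blinfun_apply (functional_of_free (free_delta x)) f = apply_lip0 f x"
  by (simp add: free_delta.rep_eq lip0_delta.rep_eq)

lemma free_delta_zero: "free_delta 0 = 0"
proof -
  have "functional_of_free (free_delta 0) = functional_of_free 0"
    by (rule blinfun_eqI) (simp add: functional_of_free_delta lip0_zero zero_lipschitz_free.rep_eq)
  then show ?thesis by (simp add: functional_of_free_inject)
qed

lemma norm_free_delta_diff_le: "norm (free_delta x - free_delta y) \<le> dist x y"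
  unfolding norm_lipschitz_free.rep_eq minus_lipschitz_free.rep_eq free_delta.rep_eq
  using lip0_diff_le[of _ x y]
  by (intro norm_blinfun_bound)
    (auto simp: blinfun.diff_left lip0_delta.rep_eq mult.commute)

lemma closure_span_free_delta:
  "closure (span (range (free_delta :: 'a :: {metric_space, zero} \<Rightarrow> 'a lipschitz_free))) = UNIV"
proof -
  have lin: "linear (functional_of_free :: 'a lipschitz_free \<Rightarrow> _)"
    by (rule bounded_linear.linear[OF bounded_linear_functional_of_free])
  have "range lip0_delta = functional_of_free ` range (free_delta :: 'a \<Rightarrow> _)"
    by (auto simp: free_delta.rep_eq image_image)
  then have span: "span (range lip0_delta) = functional_of_free ` span (range (free_delta :: 'a \<Rightarrow> _))"
    by (simp only: linear_span_image[OF lin, symmetric])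
  have "\<mu> \<in> closure (span (range free_delta))" for \<mu> :: "'a lipschitz_free"
    unfolding closure_approachable
  proof (intro allI impI)
    fix e :: real assume "e > 0"
    with functional_of_free[of \<mu>] obtain w
      where w: "w \<in> span (range lip0_delta)" "dist w (functional_of_free \<mu>) < e"
      by (auto simp: closure_approachable)
    from w(1) obtain \<nu> where "\<nu> \<in> span (range free_delta)" "w = functional_of_free \<nu>"
      unfolding span by auto
    with w(2) show "\<exists>\<nu>\<in>span (range free_delta). dist \<nu> \<mu> < e"
      by (auto simp: dist_functional_of_free)
  qed
  then show ?thesis by auto
qed

lemma linear_functionals_eq_on_closure_span:
  fixes f g :: "'v :: real_normed_vector \<Rightarrow> real"
  assumes f: "bounded_linear f" and g: "bounded_linear g"
    and eq: "\<And>x. x \<in> S \<Longrightarrow> f x = g x"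
    and x: "x \<in> closure (span S)"
  shows "f x = g x"
proof -
  have "f x - g x = 0"
  proof (rule continuous_constant_on_closure[OF _ _ x])
    show "continuous_on (closure (span S)) (\<lambda>x. f x - g x)"
      by (rule linear_continuous_on[OF bounded_linear_sub[OF f g]])
    show "f y - g y = 0" if "y \<in> span S" for y
      using linear_eq_on_span[OF bounded_linear.linear[OF f] bounded_linear.linear[OF g] eq that]
      by simp
  qed
  then show ?thesis by simp
qed

definition restrict_functional ::
  "('a :: {metric_space, zero} lipschitz_free \<Rightarrow>\<^sub>L real) \<Rightarrow> 'a lip0" where
  "restrict_functional \<psi> = Lip0 (\<lambda>x. blinfun_apply \<psi> (free_delta x))"

lemma functional_free_delta_lipschitz:
  "\<bar>blinfun_apply \<psi> (free_delta x) - blinfun_apply \<psi> (free_delta y)\<bar> \<le> norm \<psi> * dist x y"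
proof -
  have "\<bar>blinfun_apply \<psi> (free_delta x - free_delta y)\<bar> \<le> norm \<psi> * norm (free_delta x - free_delta y)"
    using norm_blinfun[of \<psi> "free_delta x - free_delta y"] by simp
  also have "\<dots> \<le> norm \<psi> * dist x y"
    by (intro mult_left_mono norm_free_delta_diff_le) simp
  finally show ?thesis by (simp add: blinfun.diff_right)
qed

lemma apply_restrict_functional:
  "apply_lip0 (restrict_functional \<psi>) x = blinfun_apply \<psi> (free_delta x)"
  unfolding restrict_functional_def
  by (subst apply_Lip0[of _ "norm \<psi>"])
    (auto simp: free_delta_zero functional_free_delta_lipschitz)

lemma norm_restrict_functional_le: "norm (restrict_functional \<psi>) \<le> norm \<psi>"
  unfolding restrict_functional_def
  by (rule norm_Lip0_le) (auto simp: free_delta_zero functional_free_delta_lipschitz)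

lemma bounded_linear_restrict_functional: "bounded_linear restrict_functional"
proof (rule bounded_linear_intro[of _ 1])
  fix \<psi> \<theta> :: "'a lipschitz_free \<Rightarrow>\<^sub>L real" and c :: real
  show "restrict_functional (\<psi> + \<theta>) = restrict_functional \<psi> + restrict_functional \<theta>"
    by (subst apply_lip0_inject[symmetric])
      (auto simp: apply_restrict_functional lip0_apply_simps blinfun.add_left)
  show "restrict_functional (c *\<^sub>R \<psi>) = c *\<^sub>R restrict_functional \<psi>"
    by (subst apply_lip0_inject[symmetric])
      (auto simp: apply_restrict_functional lip0_apply_simps blinfun.scaleR_left)
qed (simp add: norm_restrict_functional_le)

text \<open>Passing to the Lipschitz function loses nothing: a functional on the free space
  is determined by its values at the point evaluations, by density of their span.\<close>

lemma functional_of_free_restrict_functional: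
  "blinfun_apply (functional_of_free \<mu>) (restrict_functional \<psi>) = blinfun_apply \<psi> \<mu>"
proof (rule linear_functionals_eq_on_closure_span[of _ _ "range free_delta"])
  show "bounded_linear (\<lambda>\<mu>. blinfun_apply (functional_of_free \<mu>) (restrict_functional \<psi>))"
    by (rule bounded_linear_compose[OF blinfun.bounded_linear_left bounded_linear_functional_of_free])
  show "bounded_linear (blinfun_apply \<psi>)"
    by (rule blinfun.bounded_linear_right)
qed (auto simp: functional_of_free_delta apply_restrict_functional closure_span_free_delta)

lemma subspace_free_relations: "subspace (free_relations G \<phi> chi)"
  unfolding free_relations_def by (rule subspace_closure_span)

lemma free_relations_generator:
  "g \<in> carrier G \<Longrightarrow> free_delta (\<phi> g x) - chi g *\<^sub>R free_delta x \<in> free_relations G \<phi> chi"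
  unfolding free_relations_def by (rule subsetD[OF closure_subset span_base]) blast

lemma equivariant_annihilates_relations:
  assumes f: "f \<in> lip0_equivariant G \<phi> chi" and n: "n \<in> free_relations G \<phi> chi"
  shows "blinfun_apply (functional_of_free n) f = 0"
proof (rule linear_functionals_eq_on_closure_span[OF _ _ _ n[unfolded free_relations_def]])
  show "bounded_linear (\<lambda>\<mu>. blinfun_apply (functional_of_free \<mu>) f)"
    by (rule bounded_linear_compose[OF blinfun.bounded_linear_left bounded_linear_functional_of_free])
  show "bounded_linear (\<lambda>_. 0 :: real)" by (rule bounded_linear_zero)
qed (use f in \<open>auto simp: lip0_equivariant_def minus_lipschitz_free.rep_eq
    scaleR_lipschitz_free.rep_eq blinfun.diff_left blinfun.scaleR_left functional_of_free_delta\<close>)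

lemma restrict_functional_equivariant:
  assumes "\<And>n. n \<in> free_relations G \<phi> chi \<Longrightarrow> blinfun_apply \<psi> n = 0"
  shows "restrict_functional \<psi> \<in> lip0_equivariant G \<phi> chi"
  using assms[OF free_relations_generator]
  by (auto simp: lip0_equivariant_def apply_restrict_functional blinfun.diff_right blinfun.scaleR_right)


section \<open>Averaging Lipschitz functions over the group\<close>

lemma restrict_in_linf:
  assumes "\<And>g. g \<in> carrier G \<Longrightarrow> \<bar>u g\<bar> \<le> K"
  shows "restrict u (carrier G) \<in> linf G"
  using assms by (auto simp: linf_def intro!: boundedI[where B = K])

lemma mean_add:
  assumes "bi_invariant_mean G m" "restrict u (carrier G) \<in> linf G" "restrict v (carrier G) \<in> linf G"
  shows "m (\<lambda>g\<in>carrier G. u g + v g) = m (restrict u (carrier G)) + m (restrict v (carrier G))"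
proof -
  have "m (\<lambda>g\<in>carrier G. restrict u (carrier G) g + restrict v (carrier G) g)
      = m (restrict u (carrier G)) + m (restrict v (carrier G))"
    using assms unfolding bi_invariant_mean_def by blast
  then show ?thesis by (simp cong: restrict_cong)
qed

lemma mean_scale:
  assumes "bi_invariant_mean G m" "restrict u (carrier G) \<in> linf G"
  shows "m (\<lambda>g\<in>carrier G. c * u g) = c * m (restrict u (carrier G))"
proof -
  have "m (\<lambda>g\<in>carrier G. c * restrict u (carrier G) g) = c * m (restrict u (carrier G))"
    using assms unfolding bi_invariant_mean_def by blast
  then show ?thesis by (simp cong: restrict_cong)
qed

lemma mean_left_invariant:
  assumes "bi_invariant_mean G m" "h \<in> carrier G" "u \<in> linf G"
  shows "m (\<lambda>g\<in>carrier G. u (h \<otimes>\<^bsub>G\<^esub> g)) = m u"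
  using assms unfolding bi_invariant_mean_def by blast

lemma mean_const:
  assumes "bi_invariant_mean G m"
  shows "m (\<lambda>g\<in>carrier G. c) = c"
proof -
  have "m (\<lambda>g\<in>carrier G. c * 1) = c * m (\<lambda>g\<in>carrier G. 1)"
    by (rule mean_scale[OF assms]) (rule restrict_in_linf[of _ _ 1], simp)
  moreover have "m (\<lambda>g\<in>carrier G. 1) = 1"
    using assms unfolding bi_invariant_mean_def by blast
  ultimately show ?thesis by simp
qed

text \<open>A mean has norm one as a functional, so rescaling \<open>u\<close> into the unit ball gives the bound.
  Reading off \<open>\<bar>m v\<bar> \<le> 1\<close> from the supremum over the unit ball being \<open>1\<close> requires
  that supremum to be taken over a bounded set.\<close>

lemma mean_abs_le:
  assumes G: "carrier G \<noteq> {}" and m: "bi_invariant_mean G m"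
    and K: "\<And>g. g \<in> carrier G \<Longrightarrow> \<bar>u g\<bar> \<le> K"
  shows "\<bar>m (restrict u (carrier G))\<bar> \<le> K"
proof (rule field_le_epsilon)
  fix e :: real assume e: "e > 0"
  have "K \<ge> 0"
    using G K by (meson abs_ge_zero ex_in_conv order_trans)
  \<comment> \<open>Rescaling by \<open>K + e\<close> instead of \<open>K\<close> avoids dividing by zero when \<open>K = 0\<close>.\<close>
  with e have c: "K + e > 0" by simp
  let ?B = "{u \<in> linf G. linf_norm G u \<le> 1}"
  let ?v = "\<lambda>g\<in>carrier G. inverse (K + e) * u g"
  have v: "\<bar>inverse (K + e) * u g\<bar> \<le> 1" if "g \<in> carrier G" for g
    using K[OF that] c e by (simp add: abs_mult field_simps)
  have "?v \<in> linf G"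
    by (rule restrict_in_linf[OF v])
  moreover have "linf_norm G ?v \<le> 1"
    unfolding linf_norm_def using v by (intro cSUP_least[OF G]) auto
  ultimately have vB: "?v \<in> ?B" by simp
  obtain C where C: "\<And>u. u \<in> linf G \<Longrightarrow> \<bar>m u\<bar> \<le> C * linf_norm G u"
    using m unfolding bi_invariant_mean_def by blast
  have "bdd_above ((\<lambda>u. \<bar>m u\<bar>) ` ?B)"
  proof (rule bdd_aboveI2[where M = "\<bar>C\<bar>"])
    fix w assume w: "w \<in> ?B"
    have "bdd_above ((\<lambda>g. \<bar>w g\<bar>) ` carrier G)"
      using w by (fastforce simp: linf_def bounded_iff bdd_above_def)
    then have "0 \<le> linf_norm G w"
      unfolding linf_norm_def using G by (metis abs_ge_zero cSUP_upper2 ex_in_conv)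
    then have "C * linf_norm G w \<le> \<bar>C\<bar> * 1"
      using w by (intro mult_mono) auto
    with C[of w] w show "\<bar>m w\<bar> \<le> \<bar>C\<bar>" by simp
  qed
  then have "\<bar>m ?v\<bar> \<le> (SUP u\<in>?B. \<bar>m u\<bar>)"
    by (rule cSUP_upper[OF vB])
  also have "\<dots> = 1"
    using m unfolding bi_invariant_mean_def by blast
  finally have "\<bar>m ?v\<bar> \<le> 1" .
  moreover have "m ?v = inverse (K + e) * m (restrict u (carrier G))"
    by (rule mean_scale[OF m restrict_in_linf[OF K]])
  ultimately have "inverse (K + e) * \<bar>m (restrict u (carrier G))\<bar> \<le> 1"
    using c by (simp only: abs_mult) simp
  then show "\<bar>m (restrict u (carrier G))\<bar> \<le> K + e"
    using c by (simp add: field_simps)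
qed

locale averaged_similarity_action = group G for G :: "('g, 'b) monoid_scheme" (structure) +
  fixes \<phi> :: "'g \<Rightarrow> 'a :: {metric_space, zero} \<Rightarrow> 'a"
    and chi :: "'g \<Rightarrow> real"
    and m :: "('g \<Rightarrow> real) \<Rightarrow> real"
  assumes similarities: "acts_by_similarities G \<phi> chi"
    and fixes_zero: "g \<in> carrier G \<Longrightarrow> \<phi> g 0 = 0"
    and mean: "bi_invariant_mean G m"
begin

definition twist :: "'a lip0 \<Rightarrow> 'a \<Rightarrow> 'g \<Rightarrow> real" where
  "twist f x g = chi g * apply_lip0 f (\<phi> (inv g) x)"

definition average :: "'a lip0 \<Rightarrow> 'a lip0" where
  "average f = Lip0 (\<lambda>x. m (restrict (twist f x) (carrier G)))"

lemma chi_pos: "g \<in> carrier G \<Longrightarrow> chi g > 0"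
  using similarities
  by (auto simp: acts_by_similarities_def hom_def positive_reals_group_def Pi_iff)

lemma chi_mult: "g \<in> carrier G \<Longrightarrow> h \<in> carrier G \<Longrightarrow> chi (g \<otimes> h) = chi g * chi h"
  using similarities
  by (auto simp: acts_by_similarities_def hom_def positive_reals_group_def)

lemma chi_one: "chi \<one> = 1"
  using chi_mult[of \<one> \<one>] chi_pos[of \<one>] by simp

lemma chi_inv: "g \<in> carrier G \<Longrightarrow> chi g * chi (inv g) = 1"
  using chi_mult[of g "inv g"] chi_one by simp

lemma dist_action: "g \<in> carrier G \<Longrightarrow> dist (\<phi> g x) (\<phi> g y) = chi g * dist x y"
  using similarities by (auto simp: acts_by_similarities_def)

lemma action_mult: "g \<in> carrier G \<Longrightarrow> h \<in> carrier G \<Longrightarrow> \<phi> (g \<otimes> h) x = \<phi> g (\<phi> h x)"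
  using similarities group_action.composition_rule[of G UNIV \<phi> x g h]
  by (auto simp: acts_by_similarities_def)

lemma action_one: "\<phi> \<one> x = x"
  using similarities group_action.id_eq_one[of G UNIV \<phi>]
  by (auto simp: acts_by_similarities_def dest: fun_cong[of _ _ x])

lemma action_inv: "g \<in> carrier G \<Longrightarrow> \<phi> (inv g) (\<phi> g x) = x"
  using action_mult[of "inv g" g x] action_one by simp

lemma twist_add: "twist (f + f') x g = twist f x g + twist f' x g"
  by (simp add: twist_def lip0_apply_simps algebra_simps)

lemma twist_scaleR: "twist (c *\<^sub>R f) x g = c * twist f x g"
  by (simp add: twist_def lip0_apply_simps algebra_simps)

text \<open>The scaling by \<open>inv g\<close> compensates exactly for the weight \<open>chi g\<close>, so that all twists
  of \<open>f\<close> share the Lipschitz constant of \<open>f\<close>.\<close>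

lemma twist_lipschitz:
  assumes g: "g \<in> carrier G"
  shows "\<bar>twist f x g - twist f y g\<bar> \<le> norm f * dist x y"
proof -
  have "\<bar>twist f x g - twist f y g\<bar>
      = chi g * \<bar>apply_lip0 f (\<phi> (inv g) x) - apply_lip0 f (\<phi> (inv g) y)\<bar>"
    using chi_pos[OF g] by (simp add: twist_def abs_mult flip: right_diff_distrib)
  also have "\<dots> \<le> chi g * (norm f * dist (\<phi> (inv g) x) (\<phi> (inv g) y))"
    using chi_pos[OF g] by (intro mult_left_mono lip0_diff_le) simp
  also have "\<dots> = (chi g * chi (inv g)) * (norm f * dist x y)"
    using g by (simp add: dist_action)
  finally show ?thesis using chi_inv[OF g] by simp
qed

lemma twist_zero: "g \<in> carrier G \<Longrightarrow> twist f 0 g = 0"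
  by (simp add: twist_def fixes_zero lip0_zero)

lemma twist_in_linf: "restrict (twist f x) (carrier G) \<in> linf G"
  using twist_lipschitz[of _ f x 0] twist_zero
  by (intro restrict_in_linf[of _ _ "norm f * dist x 0"]) simp

lemma mean_twist_zero: "m (restrict (twist f 0) (carrier G)) = 0"
  using mean_const[OF mean, of 0] twist_zero by (simp cong: restrict_cong)

lemma mean_twist_lipschitz:
  "\<bar>m (restrict (twist f x) (carrier G)) - m (restrict (twist f y) (carrier G))\<bar> \<le> norm f * dist x y"
proof -
  have neg: "(\<lambda>g\<in>carrier G. - 1 * twist f y g) \<in> linf G"
    using twist_lipschitz[of _ f y 0] twist_zero
    by (intro restrict_in_linf[of _ _ "norm f * dist y 0"]) simp
  have "m (\<lambda>g\<in>carrier G. twist f x g + - 1 * twist f y g)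
      = m (restrict (twist f x) (carrier G)) + m (\<lambda>g\<in>carrier G. - 1 * twist f y g)"
    by (rule mean_add[OF mean twist_in_linf neg])
  also have "m (\<lambda>g\<in>carrier G. - 1 * twist f y g) = - 1 * m (restrict (twist f y) (carrier G))"
    by (rule mean_scale[OF mean twist_in_linf])
  finally have "m (restrict (twist f x) (carrier G)) - m (restrict (twist f y) (carrier G))
      = m (\<lambda>g\<in>carrier G. twist f x g + - 1 * twist f y g)"
    by linarith
  also have "\<bar>\<dots>\<bar> \<le> norm f * dist x y"
    using twist_lipschitz one_closed by (intro mean_abs_le[OF _ mean]) auto
  finally show ?thesis .
qed

lemma apply_average: "apply_lip0 (average f) x = m (restrict (twist f x) (carrier G))"
  unfolding average_def
  by (subst apply_Lip0[of _ "norm f"]) (auto simp: mean_twist_zero mean_twist_lipschitz)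

lemma norm_average_le: "norm (average f) \<le> norm f"
  unfolding average_def
  by (rule norm_Lip0_le) (auto simp: mean_twist_zero mean_twist_lipschitz)

lemma bounded_linear_average: "bounded_linear average"
proof (rule bounded_linear_intro[of _ 1])
  fix f f' and c :: real
  show "average (f + f') = average f + average f'"
    by (subst apply_lip0_inject[symmetric], rule ext)
      (simp add: apply_average lip0_apply_simps mean_add[OF mean twist_in_linf twist_in_linf, symmetric]
        twist_add cong: restrict_cong)
  show "average (c *\<^sub>R f) = c *\<^sub>R average f"
    by (subst apply_lip0_inject[symmetric], rule ext)
      (simp add: apply_average lip0_apply_simps mean_scale[OF mean twist_in_linf, symmetric]
        twist_scaleR cong: restrict_cong)
qed (simp add: norm_average_le)

lemma twist_translate:
  assumes "h \<in> carrier G" "g \<in> carrier G"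
  shows "twist f (\<phi> h x) (h \<otimes> g) = chi h * twist f x g"
  using assms
  by (simp add: twist_def chi_mult inv_mult_group action_mult action_inv)

text \<open>Replacing \<open>x\<close> by \<open>\<phi> h x\<close> translates the averaged function by \<open>h\<close> on the left, up to the
  factor \<open>chi h\<close>; the mean does not notice the translation.\<close>

lemma average_equivariant: "average f \<in> lip0_equivariant G \<phi> chi"
  unfolding lip0_equivariant_def
proof (intro CollectI ballI allI)
  fix h x assume h: "h \<in> carrier G"
  let ?u = "restrict (twist f (\<phi> h x)) (carrier G)"
  have "m ?u = m (\<lambda>g\<in>carrier G. ?u (h \<otimes> g))"
    by (rule mean_left_invariant[OF mean h twist_in_linf, symmetric])
  also have "(\<lambda>g\<in>carrier G. ?u (h \<otimes> g)) = (\<lambda>g\<in>carrier G. chi h * twist f x g)"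
    using h by (intro restrict_ext) (simp add: twist_translate)
  also have "m \<dots> = chi h * m (restrict (twist f x) (carrier G))"
    by (rule mean_scale[OF mean twist_in_linf])
  finally show "apply_lip0 (average f) (\<phi> h x) = chi h * apply_lip0 (average f) x"
    unfolding apply_average .
qed

lemma average_fixes_equivariant:
  assumes f: "f \<in> lip0_equivariant G \<phi> chi"
  shows "average f = f"
proof (subst apply_lip0_inject[symmetric], rule ext)
  fix x
  have "twist f x g = apply_lip0 f x" if g: "g \<in> carrier G" for g
    using f g chi_inv[OF g]
    by (simp add: twist_def lip0_equivariant_def flip: mult.assoc)
  then have "restrict (twist f x) (carrier G) = (\<lambda>g\<in>carrier G. apply_lip0 f x)"
    by (intro restrict_ext) simp
  then show "apply_lip0 (average f) x = apply_lip0 f x"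
    by (simp add: apply_average mean_const[OF mean])
qed

definition averaging_projection :: "'a lip0 \<Rightarrow>\<^sub>L 'a lip0" where
  "averaging_projection = Blinfun average"

lemma apply_averaging_projection: "blinfun_apply averaging_projection = average"
  unfolding averaging_projection_def by (rule bounded_linear_Blinfun_apply[OF bounded_linear_average])

lemma averaging_projection_idem: "averaging_projection o\<^sub>L averaging_projection = averaging_projection"
  by (rule blinfun_eqI)
    (simp add: apply_averaging_projection average_fixes_equivariant average_equivariant)

lemma range_averaging_projection: "range (blinfun_apply averaging_projection) = lip0_equivariant G \<phi> chi"
  unfolding apply_averaging_projection
proof (intro equalityI subsetI)
  fix f assume "f \<in> lip0_equivariant G \<phi> chi"
  then show "f \<in> range average"
    by (intro range_eqI[of _ _ f]) (simp add: average_fixes_equivariant)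
qed (auto simp: average_equivariant)

lemma norm_averaging_projection_le: "norm averaging_projection \<le> 1"
  by (rule norm_blinfun_bound) (auto simp: apply_averaging_projection norm_average_le)

lemma norm_averaging_projection:
  assumes "lip0_equivariant G \<phi> chi \<noteq> {0}"
  shows "norm averaging_projection = 1"
proof -
  have "0 \<in> lip0_equivariant G \<phi> chi"
    by (simp add: lip0_equivariant_def lip0_apply_simps)
  with assms obtain f where f: "f \<in> lip0_equivariant G \<phi> chi" "f \<noteq> 0" by blast
  have "norm f \<le> norm averaging_projection * norm f"
    using norm_blinfun[of averaging_projection f]
    by (simp add: apply_averaging_projection average_fixes_equivariant[OF f(1)])
  then have "1 \<le> norm averaging_projection" using f(2) by simp
  with norm_averaging_projection_le show ?thesis by simp
qed


section \<open>Embedding the quotient into the bidual\<close>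

definition bidual_map :: "'a lipschitz_free \<Rightarrow> ('a lipschitz_free \<Rightarrow>\<^sub>L real) \<Rightarrow>\<^sub>L real" where
  "bidual_map \<mu> = functional_of_free \<mu> o\<^sub>L averaging_projection o\<^sub>L Blinfun restrict_functional"

lemma apply_bidual_map:
  "blinfun_apply (bidual_map \<mu>) \<psi> =
    blinfun_apply (functional_of_free \<mu>) (average (restrict_functional \<psi>))"
  by (simp add: bidual_map_def apply_averaging_projection
      bounded_linear_Blinfun_apply[OF bounded_linear_restrict_functional])

lemma bidual_map_add: "bidual_map (\<mu> + \<nu>) = bidual_map \<mu> + bidual_map \<nu>"
  by (rule blinfun_eqI) (simp add: apply_bidual_map plus_lipschitz_free.rep_eq blinfun.add_left)

lemma bidual_map_scaleR: "bidual_map (c *\<^sub>R \<mu>) = c *\<^sub>R bidual_map \<mu>"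
  by (rule blinfun_eqI) (simp add: apply_bidual_map scaleR_lipschitz_free.rep_eq blinfun.scaleR_left)

lemma bidual_map_relations: "n \<in> free_relations G \<phi> chi \<Longrightarrow> bidual_map n = 0"
  by (rule blinfun_eqI)
    (simp add: apply_bidual_map equivariant_annihilates_relations[OF average_equivariant])

lemma norm_bidual_map_le: "norm (bidual_map \<mu>) \<le> norm \<mu>"
proof (rule norm_blinfun_bound)
  fix \<psi> :: "'a lipschitz_free \<Rightarrow>\<^sub>L real"
  have "norm (blinfun_apply (bidual_map \<mu>) \<psi>) \<le> norm \<mu> * norm (average (restrict_functional \<psi>))"
    unfolding apply_bidual_map norm_lipschitz_free.rep_eq by (rule norm_blinfun)
  also have "\<dots> \<le> norm \<mu> * norm \<psi>"
    by (intro mult_left_mono order_trans[OF norm_average_le norm_restrict_functional_le]) simp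
  finally show "norm (blinfun_apply (bidual_map \<mu>) \<psi>) \<le> norm \<mu> * norm \<psi>" .
qed simp

text \<open>The upper bound uses that \<open>bidual_map\<close> is constant on cosets; for the lower bound, a
  functional that annihilates the relations and attains the quotient norm restricts to a Lipschitz
  function which averaging leaves unchanged.\<close>

lemma norm_bidual_map:
  "norm (bidual_map \<mu>) = coset_norm (subspace_coset (free_relations G \<phi> chi) \<mu>)"
proof (rule antisym)
  let ?N = "free_relations G \<phi> chi"
  show "norm (bidual_map \<mu>) \<le> coset_norm (subspace_coset ?N \<mu>)"
  proof (rule coset_norm_greatest[OF subspace_free_relations])
    fix n assume "n \<in> ?N"
    then show "norm (bidual_map \<mu>) \<le> norm (\<mu> + n)"
      using norm_bidual_map_le[of "\<mu> + n"] by (simp add: bidual_map_add bidual_map_relations)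
  qed
  obtain \<psi> where \<psi>: "norm \<psi> \<le> 1" "\<And>n. n \<in> ?N \<Longrightarrow> blinfun_apply \<psi> n = 0"
    "blinfun_apply \<psi> \<mu> = coset_norm (subspace_coset ?N \<mu>)"
    by (rule annihilating_functional_attains_coset_norm[OF subspace_free_relations]) blast
  have "blinfun_apply (bidual_map \<mu>) \<psi> = coset_norm (subspace_coset ?N \<mu>)"
    by (simp add: apply_bidual_map functional_of_free_restrict_functional \<psi>(3)
        average_fixes_equivariant[OF restrict_functional_equivariant[OF \<psi>(2)]])
  then have "coset_norm (subspace_coset ?N \<mu>) \<le> norm (bidual_map \<mu>) * norm \<psi>"
    using norm_blinfun[of "bidual_map \<mu>" \<psi>] by simp
  also have "\<dots> \<le> norm (bidual_map \<mu>)"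
    using \<psi>(1) by (simp add: mult_left_le)
  finally show "coset_norm (subspace_coset ?N \<mu>) \<le> norm (bidual_map \<mu>)" .
qed

text \<open>Any choice of representative gives the same value, since \<open>bidual_map\<close> kills the relations.\<close>

lemma quotient_linear_isometry_bidual_map:
  "quotient_linear_isometry (free_relations G \<phi> chi) (\<lambda>A. bidual_map (SOME \<nu>. \<nu> \<in> A))"
proof -
  let ?N = "free_relations G \<phi> chi"
  have "bidual_map (SOME \<nu>. \<nu> \<in> subspace_coset ?N \<mu>) = bidual_map \<mu>" for \<mu>
  proof (rule someI2[where a = \<mu>])
    show "\<mu> \<in> subspace_coset ?N \<mu>"
      using subspace_0[OF subspace_free_relations] by (auto simp: subspace_coset_def intro!: image_eqI)
  qed (auto simp: subspace_coset_def bidual_map_add bidual_map_relations)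
  then show ?thesis
    by (simp add: quotient_linear_isometry_def bidual_map_add bidual_map_scaleR norm_bidual_map)
qed

end


theorem corollary3p11:
  fixes G :: "('g, 'b) monoid_scheme"
    and \<phi> :: "'g \<Rightarrow> 'a :: {metric_space, zero} \<Rightarrow> 'a"
    and chi :: "'g \<Rightarrow> real"
  assumes "amenable G"
    and "\<exists>x :: 'a. x \<noteq> 0"
    and "acts_by_similarities G \<phi> chi"
    and "\<forall>g\<in>carrier G. \<phi> g 0 = 0"
  shows
    "(\<exists>T :: 'a lipschitz_free set \<Rightarrow> (('a lipschitz_free \<Rightarrow>\<^sub>L real) \<Rightarrow>\<^sub>L real).
        quotient_linear_isometry (free_relations G \<phi> chi) T) \<and>
     (\<forall>m. bi_invariant_mean G m \<longrightarrow>
       (\<exists>P :: 'a lip0 \<Rightarrow>\<^sub>L 'a lip0.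
         (\<forall>f x. (\<lambda>g\<in>carrier G. chi g * apply_lip0 f (\<phi> (inv\<^bsub>G\<^esub> g) x)) \<in> linf G \<and>
           apply_lip0 (blinfun_apply P f) x =
             m (\<lambda>g\<in>carrier G. chi g * apply_lip0 f (\<phi> (inv\<^bsub>G\<^esub> g) x))) \<and>
         P o\<^sub>L P = P \<and>
         range (blinfun_apply P) = lip0_equivariant G \<phi> chi \<and>
         norm P \<le> 1 \<and>
         (lip0_equivariant G \<phi> chi \<noteq> {0} \<longrightarrow> norm P = 1)))"
proof -
  have action: "averaged_similarity_action G \<phi> chi m" if "bi_invariant_mean G m" for m
    using assms that
    by (simp add: averaged_similarity_action_def averaged_similarity_action_axioms_def amenable_def)
  obtain m where "bi_invariant_mean G m"
    using assms(1) by (auto simp: amenable_def)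
  then interpret A: averaged_similarity_action G \<phi> chi m by (rule action)
  show ?thesis
  proof (intro conjI allI impI)
    show "\<exists>T :: 'a lipschitz_free set \<Rightarrow> (('a lipschitz_free \<Rightarrow>\<^sub>L real) \<Rightarrow>\<^sub>L real).
        quotient_linear_isometry (free_relations G \<phi> chi) T"
      using A.quotient_linear_isometry_bidual_map by blast
  next
    fix m' assume "bi_invariant_mean G m'"
    then interpret B: averaged_similarity_action G \<phi> chi m' by (rule action)
    have twist: "(\<lambda>g\<in>carrier G. chi g * apply_lip0 f (\<phi> (inv\<^bsub>G\<^esub> g) x))
        = restrict (B.twist f x) (carrier G)" for f x
      by (intro restrict_ext) (simp add: B.twist_def)
    show "\<exists>P :: 'a lip0 \<Rightarrow>\<^sub>L 'a lip0.
         (\<forall>f x. (\<lambda>g\<in>carrier G. chi g * apply_lip0 f (\<phi> (inv\<^bsub>G\<^esub> g) x)) \<in> linf G \<and>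
           apply_lip0 (blinfun_apply P f) x =
             m' (\<lambda>g\<in>carrier G. chi g * apply_lip0 f (\<phi> (inv\<^bsub>G\<^esub> g) x))) \<and>
         P o\<^sub>L P = P \<and>
         range (blinfun_apply P) = lip0_equivariant G \<phi> chi \<and>
         norm P \<le> 1 \<and>
         (lip0_equivariant G \<phi> chi \<noteq> {0} \<longrightarrow> norm P = 1)"
      unfolding twist
      by (intro exI[of _ B.averaging_projection])
        (simp add: B.twist_in_linf B.apply_averaging_projection B.apply_average
          B.averaging_projection_idem B.range_averaging_projection[unfolded B.apply_averaging_projection]
          B.norm_averaging_projection_le B.norm_averaging_projection)
  qed
qed

end
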